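(* If $x$ is such that $q_1(x)\ge1-\alpha\ge0.9$, then $$\left|q_n-\frac{2q_1-q_2}{\left[1+q_1-q_2+2(q_1-q_2)^2\right]^n}\right|\le\Delta_2(1-q_1)^2$$ with $$\Delta_2=\Delta_2(\alpha,n,q_1)=3+\Gamma(\alpha)(1-q_1)+n\left[1+K(\alpha)(1-q_1)\right],$$ where $\Gamma(\alpha)$ and $K(\alpha)$ are as in the context.
   Context: $(X_n)_{n\ge1}$ is a strictly stationary sequence of random variables that is 1-dependent, i.e. for every $t\ge1$ the $\sigma$-fields $\sigma(X_1,\dots,X_t)$ and $\sigma(X_{t+2},X_{t+3},\dots)$ are independent. Let $F(u)=\mathbb{P}(X_1\le u)$, and let the real number $x$ satisfy $\inf\{u: F(u)>0\}<x<\sup\{u: F(u)<1\}$. For $n\ge1$ put $q_n=q_n(x)=\mathbb{P}(\max\{X_1,\dots,X_n\}\le x)$. Let $l=l(\alpha)>t_2^3(\alpha)$, where $t_2(\alpha)$ is the second root (in increasing order) of the equation $\alpha t^3-t+1=0$, and put $\eta=1+l\alpha$, $$K(\alpha)=\frac{\dfrac{11-3\alpha}{(1-\alpha)^2}+2l(1+3\alpha)\dfrac{2+3l\alpha-\alpha(2-l\alpha)(1+l\alpha)^2}{\left[1-\alpha(1+l\alpha)^2\right]^3}}{1-\dfrac{2\alpha(1+l\alpha)}{\left[1-\alpha(1+l\alpha)^2\right]^2}},$$ $$L(\alpha)=3K(\alpha)(1+\alpha+3\alpha^2)\left[1+\alpha+3\alpha^2+K(\alpha)\alpha^3\right]+\alpha^6K^3(\alpha)+9\alpha(4+3\alpha+3\alpha^2)+55,$$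 $$E(\alpha)=0.1+\frac{\eta^5\left[1+(1-2\alpha)\eta\right]^4\left[1+\alpha(\eta-2)\right]\left[1+\eta+(1-3\alpha)\eta^2\right]}{2(1-\alpha\eta^2)^4\left[(1-\alpha\eta^2)^2-\alpha\eta^2(1+\eta-2\alpha\eta)^2\right]},$$ $$\Gamma(\alpha)=L(\alpha)+E(\alpha).$$
   Formalization: The choice of l > t_2^3(α) is restricted to those l for which 1−αη² and the bracket (1−αη²)²−αη²(1+η−2αη)² in E(α) are positive; for larger l (e.g. α=0.1, l=4, q_1=0.9, n=1) Δ_2 is negative and the bound fails. *)

theory Defs
  imports "HOL-Probability.Probability"
begin

text \<open>
  A sequence \<open>X\<^sub>1, X\<^sub>2, \<dots>\<close> is represented by \<open>X :: nat \<Rightarrow> 'a \<Rightarrow> real\<close>;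
  the value \<open>X 0\<close> is never used.
\<close>

definition strictly_stationary :: "'a measure \<Rightarrow> (nat \<Rightarrow> 'a \<Rightarrow> real) \<Rightarrow> bool" where
  "strictly_stationary M X \<longleftrightarrow>
     (\<forall>I h. finite I \<and> I \<subseteq> {1..} \<longrightarrow>
        distr M (\<Pi>\<^sub>M i\<in>I. borel) (\<lambda>\<omega>. \<lambda>i\<in>I. X (i + h) \<omega>) =
        distr M (\<Pi>\<^sub>M i\<in>I. borel) (\<lambda>\<omega>. \<lambda>i\<in>I. X i \<omega>))"

definition generated_field :: "'a measure \<Rightarrow> (nat \<Rightarrow> 'a \<Rightarrow> real) \<Rightarrow> nat set \<Rightarrow> 'a set set" where
  "generated_field M X I =
     sigma_sets (space M) (\<Union>i\<in>I. {X i -` A \<inter> space M | A. A \<in> sets borel})"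

definition one_dependent :: "'a measure \<Rightarrow> (nat \<Rightarrow> 'a \<Rightarrow> real) \<Rightarrow> bool" where
  "one_dependent M X \<longleftrightarrow>
     (\<forall>t\<ge>1. prob_space.indep_set M (generated_field M X {1..t}) (generated_field M X {t + 2..}))"

definition F :: "'a measure \<Rightarrow> (nat \<Rightarrow> 'a \<Rightarrow> real) \<Rightarrow> real \<Rightarrow> real" where
  "F M X u = measure M {\<omega> \<in> space M. X 1 \<omega> \<le> u}"

definition q :: "'a measure \<Rightarrow> (nat \<Rightarrow> 'a \<Rightarrow> real) \<Rightarrow> real \<Rightarrow> nat \<Rightarrow> real" where
  "q M X x n = measure M {\<omega> \<in> space M. Max ((\<lambda>i. X i \<omega>) ` {1..n}) \<le> x}"

text \<open>
  The list index 1 is the second position. For \<open>0 < \<alpha> < 4/27\<close> the cubic has exactly three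
  distinct real roots, one negative and two positive, so \<open>t2 \<alpha>\<close> is the smaller positive one.
\<close>

definition t2 :: "real \<Rightarrow> real" where
  "t2 \<alpha> = sorted_list_of_set {t. \<alpha> * t ^ 3 - t + 1 = 0} ! 1"

definition eta :: "real \<Rightarrow> real \<Rightarrow> real" where
  "eta \<alpha> l = 1 + l * \<alpha>"

definition K :: "real \<Rightarrow> real \<Rightarrow> real" where
  "K \<alpha> l =
     ((11 - 3 * \<alpha>) / (1 - \<alpha>)\<^sup>2
       + 2 * l * (1 + 3 * \<alpha>) *
         ((2 + 3 * l * \<alpha> - \<alpha> * (2 - l * \<alpha>) * (1 + l * \<alpha>)\<^sup>2) / (1 - \<alpha> * (1 + l * \<alpha>)\<^sup>2) ^ 3))
     / (1 - 2 * \<alpha> * (1 + l * \<alpha>) / (1 - \<alpha> * (1 + l * \<alpha>)\<^sup>2)\<^sup>2)"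

definition L :: "real \<Rightarrow> real \<Rightarrow> real" where
  "L \<alpha> l =
     3 * K \<alpha> l * (1 + \<alpha> + 3 * \<alpha>\<^sup>2) * (1 + \<alpha> + 3 * \<alpha>\<^sup>2 + K \<alpha> l * \<alpha> ^ 3)
     + \<alpha> ^ 6 * (K \<alpha> l) ^ 3 + 9 * \<alpha> * (4 + 3 * \<alpha> + 3 * \<alpha>\<^sup>2) + 55"

definition E_denominator_factor :: "real \<Rightarrow> real \<Rightarrow> real" where
  "E_denominator_factor \<alpha> l =
     (let \<eta> = eta \<alpha> l in (1 - \<alpha> * \<eta>\<^sup>2)\<^sup>2 - \<alpha> * \<eta>\<^sup>2 * (1 + \<eta> - 2 * \<alpha> * \<eta>)\<^sup>2)"

definition E :: "real \<Rightarrow> real \<Rightarrow> real" where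
  "E \<alpha> l =
     (let \<eta> = eta \<alpha> l in
        0.1 + \<eta> ^ 5 * (1 + (1 - 2 * \<alpha>) * \<eta>) ^ 4 * (1 + \<alpha> * (\<eta> - 2)) *
              (1 + \<eta> + (1 - 3 * \<alpha>) * \<eta>\<^sup>2)
            / (2 * (1 - \<alpha> * \<eta>\<^sup>2) ^ 4 * E_denominator_factor \<alpha> l))"

definition Gam :: "real \<Rightarrow> real \<Rightarrow> real" where
  "Gam \<alpha> l = L \<alpha> l + E \<alpha> l"

definition Delta2 :: "real \<Rightarrow> real \<Rightarrow> nat \<Rightarrow> real \<Rightarrow> real" where
  "Delta2 \<alpha> l n q1 = 3 + Gam \<alpha> l * (1 - q1) + real n * (1 + K \<alpha> l * (1 - q1))"

text \<open>
  \<open>K\<close> and \<open>E\<close> have poles in \<open>l\<close> and are bounds only to the left of the first one. For instance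
  at \<open>\<alpha> = 0.1\<close>, \<open>l = 4\<close> the last denominator factor of \<open>E\<close> is negative and \<open>Delta2 0.1 4 1 0.9 < 0\<close>.
  The predicate says that the denominators are positive. The remaining denominator, that
  of \<open>K\<close>, is then positive too for \<open>0 < \<alpha> \<le> 0.1\<close> and \<open>l > 0\<close>, since \<open>\<eta> \<ge> 1\<close> gives
  \<open>\<alpha> \<eta>\<^sup>2 (1 + \<eta> - 2 \<alpha> \<eta>)\<^sup>2 \<ge> 2 \<alpha> \<eta>\<close>.
  For such \<open>\<alpha>\<close> every \<open>l > (t2 \<alpha>) ^ 3\<close> close enough to \<open>(t2 \<alpha>) ^ 3\<close> satisfies it.
\<close>

definition denominators_positive :: "real \<Rightarrow> real \<Rightarrow> bool" where
  "denominators_positive \<alpha> l \<longleftrightarrow>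
     1 - \<alpha> * (eta \<alpha> l)\<^sup>2 > 0 \<and> E_denominator_factor \<alpha> l > 0"

end

theory Submission
  imports Defs
begin

text \<open>
  Write \<open>q\<^sub>m\<close> for the probability that none of \<open>X\<^sub>1, \<dots>, X\<^sub>m\<close> exceeds \<open>x\<close>, \<open>p\<^sub>k\<close> for the
  probability that all of \<open>X\<^sub>1, \<dots>, X\<^sub>k\<close> do, \<open>p = p\<^sub>1 = 1 - q\<^sub>1\<close>, \<open>\<delta> = p\<^sub>1 - p\<^sub>2 = q\<^sub>1 - q\<^sub>2\<close>
  and \<open>\<mu> = 1 + \<delta> + 2 \<delta>\<^sup>2\<close>. The approximation to \<open>q\<^sub>n\<close> is \<open>(q\<^sub>1 + \<delta>) / \<mu>\<^sup>n\<close>, so it suffices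
  that \<open>q\<^sub>n\<close> is nearly geometric with ratio \<open>1 / \<mu>\<close>: the defects \<open>q\<^sub>n\<^sub>+\<^sub>1 \<mu> - q\<^sub>n\<close> are bounded one by one and then summed.

  Let \<open>G m k\<close> be the probability that the first \<open>m\<close> variables stay below the level and the
  next \<open>k\<close> exceed it. If the variable at one site is left free, the two sides of that site are
  independent, and distinguishing what happens at the site gives
  \<open>G (m + 1) k + G m (k + 1) = q\<^sub>m p\<^sub>k\<close>. Together with \<open>p\<^sub>j\<^sub>+\<^sub>1\<^sub>+\<^sub>k \<le> p\<^sub>j p\<^sub>k\<close> this is all
  that is used of the process (\<open>calm_then_run_array\<close>).

  For \<open>n \<ge> 3\<close>, with \<open>q\<^sub>0 = q\<^sub>-\<^sub>1 = 1\<close>, unrolling the recurrence writes the decrement \<open>q\<^sub>n - q\<^sub>n\<^sub>+\<^sub>1\<close> as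
  \<open>p\<^sub>1 q\<^sub>n\<^sub>-\<^sub>1 - p\<^sub>2 q\<^sub>n\<^sub>-\<^sub>2 + p\<^sub>3 q\<^sub>n\<^sub>-\<^sub>3 - p\<^sub>4 q\<^sub>n\<^sub>-\<^sub>4\<close> with a remainder in \<open>[0, p\<^sub>5]\<close>, and
  \<open>p\<^sub>5 \<le> p\<^sup>3\<close>. Expanding the earlier \<open>q\<close>'s around \<open>q\<^sub>n\<^sub>+\<^sub>1\<close>, where each decrement is itself
  \<open>\<delta> q\<^sub>n\<^sub>+\<^sub>1\<close> up to order \<open>p\<^sup>2\<close>, shows that the defect equals
  \<open>q\<^sub>n\<^sub>+\<^sub>1 (p\<^sub>2 \<delta> - (p\<^sub>3 - p\<^sub>4))\<close> up to \<open>12 p\<^sup>3\<close>. Both terms in the bracket lie in \<open>[0, p\<^sup>2]\<close>, so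
  these defects are at most \<open>p\<^sup>2 + 12 p\<^sup>3\<close> in absolute value; the first two are small
  polynomials with the same bound (\<open>defect_bound\<close>). The initial error
  \<open>q\<^sub>1 \<mu> - (q\<^sub>1 + \<delta>)\<close> is at most \<open>2 p\<^sup>2\<close>, and since \<open>\<mu> \<ge> 1\<close> division by \<open>\<mu>\<close> amplifies nothing.
  Hence the total error is at most \<open>2 p\<^sup>2 + (n - 1) (p\<^sup>2 + 12 p\<^sup>3)\<close>
  (\<open>geometric_approximation\<close>), and it remains to see that \<open>K \<alpha> l \<ge> 12\<close> and \<open>Gam \<alpha> l \<ge> 0\<close>
  (\<open>constants_bounds\<close>).
\<close>

section \<open>Real arrays with the recurrence of one-dependent runs\<close>

text \<open>
  \<open>G m k\<close> stands for the probability of \<open>m\<close> sites without an exceedance followed by \<open>k\<close> sites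
  with one. The recurrence \<open>split_site\<close> comes from leaving the site after the first \<open>m\<close> free.
\<close>
locale run_array =
  fixes G :: "nat \<Rightarrow> nat \<Rightarrow> real"
  assumes nonneg: "0 \<le> G m k"
    and zero_zero: "G 0 0 = 1"
    and split_site: "G (Suc m) k + G m (Suc k) = G m 0 * G 0 k"
    and run_submult: "G 0 (j + 1 + k) \<le> G 0 j * G 0 k"
begin

abbreviation Q :: "nat \<Rightarrow> real" where "Q m \<equiv> G m 0"
abbreviation P :: "nat \<Rightarrow> real" where "P k \<equiv> G 0 k"
abbreviation p :: real where "p \<equiv> G 0 1"

definition \<delta> :: real where "\<delta> = p - P 2"
definition \<mu> :: real where "\<mu> = 1 + \<delta> + 2 * \<delta>\<^sup>2"

text \<open>
  \<open>H\<close> is \<open>G\<close> with one extra site in front that can never exceed the level; in the usual notation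
  this is the convention \<open>q\<^sub>-\<^sub>1 = q\<^sub>0 = 1\<close>. The recurrence survives the shift, so the unrolling below
  starts one step earlier and leaves only two small cases for direct computation.
\<close>
definition H :: "nat \<Rightarrow> nat \<Rightarrow> real" where
  "H m k = (case m of 0 \<Rightarrow> (if k = 0 then 1 else 0) | Suc i \<Rightarrow> G i k)"

lemma H_nonneg: "0 \<le> H m k"
  by (auto simp: H_def nonneg split: nat.split)

lemma H_split: "H (Suc m) k + H m (Suc k) = H m 0 * P k"
  using split_site by (auto simp: H_def split: nat.split)

lemma H_diff: "H m 0 - H (Suc m) 0 = H m 1"
  using H_split[of m 0] by (simp add: zero_zero)

lemma H_le_one: "H m 0 \<le> 1"
proof (induction m)
  case 0
  show ?case by (simp add: H_def)
next
  case (Suc m)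
  then show ?case using H_diff[of m] H_nonneg[of m 1] by simp
qed

text \<open>An upper bound for the remainder left when the alternating recurrence is cut off.\<close>
lemma H_le_run: "H m k \<le> P k"
proof (cases m)
  case 0
  then show ?thesis using nonneg[of 0 k] by (simp add: H_def zero_zero)
next
  case (Suc i)
  have "H (Suc i) k \<le> H i 0 * P k"
    using H_split[of i k] H_nonneg[of i "Suc k"] by linarith
  also have "\<dots> \<le> 1 * P k"
    by (rule mult_right_mono) (use H_le_one nonneg in auto)
  finally show ?thesis by (simp add: Suc)
qed

lemma run_antimono: "P (Suc k) \<le> P k"
  using split_site[of 0 k] nonneg[of "Suc 0" k] by (simp add: zero_zero)

text \<open>
  Each omitted site in a run costs no more than a factor, so a run of length \<open>2 i - 1\<close> has
  probability at most \<open>p ^ i\<close>. This fixes the order in \<open>p\<close> of every term in the expansions.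
\<close>
lemma run_bounds:
  "0 \<le> p" "0 \<le> P 2" "P 2 \<le> p" "P 3 \<le> p\<^sup>2" "P 4 \<le> P 3" "P 5 \<le> p ^ 3" "p \<le> 1"
proof -
  show "0 \<le> p" "0 \<le> P 2" by (rule nonneg)+
  show "P 2 \<le> p" "P 4 \<le> P 3" "p \<le> 1"
    using run_antimono[of 1] run_antimono[of 3] run_antimono[of 0] zero_zero
    by (simp_all add: numeral_eq_Suc)
  show P3: "P 3 \<le> p\<^sup>2"
    using run_submult[of 1 1] by (simp add: numeral_eq_Suc)
  have "P 5 \<le> p * P 3"
    using run_submult[of 1 3] by (simp add: numeral_eq_Suc)
  also have "\<dots> \<le> p * p\<^sup>2"
    by (rule mult_left_mono[OF P3 nonneg])
  finally show "P 5 \<le> p ^ 3" by (simp add: power3_eq_cube power2_eq_square)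
qed

lemma \<delta>_bounds: "0 \<le> \<delta>" "\<delta> \<le> p"
  using run_bounds by (simp_all add: \<delta>_def)

lemma \<mu>_ge_one: "1 \<le> \<mu>"
  using \<delta>_bounds by (simp add: \<mu>_def)

lemma abs_div_\<mu>_le: "\<bar>z / \<mu>\<bar> \<le> \<bar>z\<bar>"
  using \<mu>_ge_one mult_left_mono[of 1 \<mu> "\<bar>z\<bar>"] by (simp add: divide_le_eq)

lemma Q_one: "Q 1 = 1 - p"
  using split_site[of 0 0] by (simp add: zero_zero)

lemma Q_two: "Q 2 = 1 - p - \<delta>"
  using split_site[of 1 0] split_site[of 0 1] Q_one
  by (simp add: zero_zero \<delta>_def numeral_eq_Suc)

lemma Q_three: "Q 3 = 1 - p - 2 * \<delta> + p\<^sup>2 - P 3"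
proof -
  have "Q 3 = Q 2 - G 2 1" "G 2 1 = Q 1 * p - G 1 2" "G 1 2 = P 2 - P 3"
    using split_site[of 2 0] split_site[of 1 1] split_site[of 0 2]
    by (simp_all add: zero_zero numeral_eq_Suc)
  then show ?thesis
    unfolding Q_one Q_two by (simp add: \<delta>_def power2_eq_square algebra_simps)
qed

text \<open>
  Second-order expansion of a decrement. All earlier values of \<open>H\<close> are written as the last one,
  \<open>R\<close>, plus a sum of decrements \<open>b\<^sub>i\<close>. Substituting the first-order approximation
  \<open>b\<^sub>i = \<delta> R + O(p\<^sup>2)\<close> into the exact formula for \<open>b\<^sub>4\<close> yields
  \<open>b\<^sub>4 = R (\<delta> + 2 \<delta>\<^sup>2 - p\<^sub>2 \<delta> + p\<^sub>3 - p\<^sub>4) + O(p\<^sup>3)\<close>; the summand \<open>2 \<delta>\<^sup>2\<close> of \<open>\<mu>\<close> is there to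
  cancel the corresponding term.
\<close>
lemma defect_bound_far:
  "\<bar>H (m + 5) 0 * \<mu> - H (m + 4) 0\<bar> \<le> p\<^sup>2 + 12 * p ^ 3"
proof -
  define R where "R = H (m + 5) 0"
  define b0 b1 b2 b3 b4
    where b: "b0 = H m 1" "b1 = H (m + 1) 1" "b2 = H (m + 2) 1" "b3 = H (m + 3) 1" "b4 = H (m + 4) 1"
  define h2 h3 h4 h5
    where h: "h2 = H m 3" "h3 = H (m + 1) 3" "h4 = H (m + 2) 3" "h5 = H m 5"
  define s where "s = P 2"
  have R4: "H (m + 4) 0 = R + b4"
    and R3: "H (m + 3) 0 = R + b4 + b3"
    and R2: "H (m + 2) 0 = R + b4 + b3 + b2"
    and R1: "H (m + 1) 0 = R + b4 + b3 + b2 + b1"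
    and R0: "H m 0 = R + b4 + b3 + b2 + b1 + b0"
    using H_diff[of m] H_diff[of "m + 1"] H_diff[of "m + 2"] H_diff[of "m + 3"] H_diff[of "m + 4"]
    by (simp_all add: R_def b numeral_eq_Suc)
  have R: "0 \<le> R" "R \<le> 1"
    by (simp_all add: R_def H_nonneg H_le_one)
  have b_nn: "0 \<le> b0" "0 \<le> b1" "0 \<le> b2" "0 \<le> b3" "0 \<le> b4"
    and b_le: "b0 \<le> p" "b1 \<le> p" "b2 \<le> p" "b3 \<le> p" "b4 \<le> p"
    by (simp_all add: b H_nonneg H_le_run)
  have h_nn: "0 \<le> h2" "0 \<le> h3" "0 \<le> h4" "0 \<le> h5"
    by (simp_all add: h H_nonneg)
  have h_le: "h2 \<le> p\<^sup>2" "h3 \<le> p\<^sup>2" "h4 \<le> p\<^sup>2" "h5 \<le> p ^ 3"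
    using H_le_run[of m 3] H_le_run[of "m + 1" 3] H_le_run[of "m + 2" 3] H_le_run[of m 5]
      run_bounds by (simp_all add: h)
  have d: "0 \<le> \<delta>" "\<delta> \<le> p" and s: "0 \<le> s" "s \<le> p" and ds: "p = \<delta> + s"
    using \<delta>_bounds run_bounds by (simp_all add: s_def \<delta>_def)
  have p34: "0 \<le> P 4" "P 4 \<le> P 3" "P 3 \<le> p\<^sup>2" "0 \<le> p"
    using run_bounds nonneg by auto
  \<comment> \<open>The errors of order \<open>p\<^sup>2\<close> in the approximation of \<open>b4\<close>, \<open>b3\<close>, \<open>b2\<close> by \<open>\<delta> * R\<close>, obtained
    by cutting the recurrence after two terms.\<close>
  define u4 where "u4 = \<delta> * (b4 + b3) - s * b2 + h4"
  define u3 where "u3 = \<delta> * (b4 + b3 + b2) - s * b1 + h3"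
  define u2 where "u2 = \<delta> * (b4 + b3 + b2 + b1) - s * b0 + h2"
  have b4: "b4 = \<delta> * R + u4"
    using H_split[of "m + 3" 1] H_split[of "m + 2" 2] R3 R2
    by (simp add: u4_def b h s_def \<delta>_def numeral_eq_Suc algebra_simps)
  have b3: "b3 = \<delta> * R + u3"
    using H_split[of "m + 2" 1] H_split[of "m + 1" 2] R2 R1
    by (simp add: u3_def b h s_def \<delta>_def numeral_eq_Suc algebra_simps)
  have b2: "b2 = \<delta> * R + u2"
    using H_split[of "m + 1" 1] H_split[of m 2] R1 R0
    by (simp add: u2_def b h s_def \<delta>_def numeral_eq_Suc algebra_simps)
  \<comment> \<open>Four terms are needed for \<open>b4\<close> itself: the remainder \<open>h5\<close> is then of order \<open>p\<^sup>3\<close>.\<close>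
  have H5: "b4 = p * H (m + 3) 0 - s * H (m + 2) 0 + P 3 * H (m + 1) 0 - P 4 * H m 0 + h5"
    using H_split[of "m + 3" 1] H_split[of "m + 2" 2] H_split[of "m + 1" 3] H_split[of m 4]
    by (simp add: b h s_def numeral_eq_Suc algebra_simps)
  define rest where "rest = \<delta> * (u4 + u3) - s * u2
    + (P 3 - P 4) * (b4 + b3 + b2 + b1) - P 4 * b0 + h5"
  have "\<delta> * (b4 + b3) = \<delta> * (2 * \<delta> * R + u4 + u3)" "s * b2 = s * (\<delta> * R + u2)"
    using b4 b3 b2 by simp_all
  moreover have "b4 = \<delta> * R + \<delta> * (b4 + b3) - s * b2 + (P 3 - P 4) * R
      + (P 3 - P 4) * (b4 + b3 + b2 + b1) - P 4 * b0 + h5"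
    using H5 unfolding R3 R2 R1 R0 ds by (simp add: algebra_simps)
  ultimately have "b4 = \<delta> * R + 2 * \<delta>\<^sup>2 * R - s * \<delta> * R + (P 3 - P 4) * R + rest"
    by (simp add: rest_def power2_eq_square algebra_simps)
  then have defect: "H (m + 5) 0 * \<mu> - H (m + 4) 0 = R * (s * \<delta> - (P 3 - P 4)) - rest"
    unfolding R4 R_def[symmetric] by (simp add: \<mu>_def algebra_simps)

  have sq: "a * c \<le> p\<^sup>2" if "0 \<le> a" "a \<le> p" "0 \<le> c" "c \<le> p" for a c
    using mult_mono[of a p c p] that by (simp add: power2_eq_square)
  have nn: "0 \<le> s * b0" "0 \<le> s * b1" "0 \<le> s * b2" "0 \<le> s * \<delta>"
      "0 \<le> \<delta> * b1" "0 \<le> \<delta> * b2" "0 \<le> \<delta> * b3" "0 \<le> \<delta> * b4"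
    using b_nn s d by simp_all
  have le: "s * b0 \<le> p\<^sup>2" "s * b1 \<le> p\<^sup>2" "s * b2 \<le> p\<^sup>2" "s * \<delta> \<le> p\<^sup>2"
      "\<delta> * b1 \<le> p\<^sup>2" "\<delta> * b2 \<le> p\<^sup>2" "\<delta> * b3 \<le> p\<^sup>2" "\<delta> * b4 \<le> p\<^sup>2"
    by (rule sq; fact b_nn b_le s d)+
  have u4: "- p\<^sup>2 \<le> u4" "u4 \<le> 3 * p\<^sup>2" and u3: "- p\<^sup>2 \<le> u3" "u3 \<le> 4 * p\<^sup>2"
    and u2: "- p\<^sup>2 \<le> u2" "u2 \<le> 5 * p\<^sup>2"
    using nn le h_nn h_le unfolding u4_def u3_def u2_def distrib_left by linarith+
  have 1: "\<delta> * (- 2 * p\<^sup>2) \<le> \<delta> * (u4 + u3)" "\<delta> * (u4 + u3) \<le> \<delta> * (7 * p\<^sup>2)"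
    by (rule mult_left_mono; use u4 u3 d in linarith)+
  have 2: "s * (- p\<^sup>2) \<le> s * u2" "s * u2 \<le> s * (5 * p\<^sup>2)"
    by (rule mult_left_mono; use u2 s in linarith)+
  have 3: "0 \<le> (P 3 - P 4) * (b4 + b3 + b2 + b1)"
    using p34 b_nn by simp
  have 4: "(P 3 - P 4) * (b4 + b3 + b2 + b1) \<le> p\<^sup>2 * (4 * p)"
    by (rule mult_mono) (use p34 b_nn b_le in auto)
  have 5: "0 \<le> P 4 * b0" "P 4 * b0 \<le> p\<^sup>2 * p"
    using p34 b_nn b_le by (auto intro!: mult_mono)
  \<comment> \<open>Splitting \<open>p ^ 3\<close> along \<open>p = \<delta> + s\<close> makes the final estimate linear in \<open>\<delta> * p\<^sup>2\<close> and
    \<open>s * p\<^sup>2\<close>; the upper bound is \<open>7 \<delta> p\<^sup>2 + s p\<^sup>2 + 4 p\<^sup>3 + p\<^sup>3 \<le> 12 p\<^sup>3\<close>.\<close>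
  have 6: "p ^ 3 = \<delta> * p\<^sup>2 + s * p\<^sup>2" "p\<^sup>2 * p = \<delta> * p\<^sup>2 + s * p\<^sup>2"
    unfolding distrib_right[symmetric] ds[symmetric]
    by (simp_all add: power3_eq_cube power2_eq_square)
  have 7: "0 \<le> \<delta> * p\<^sup>2" "0 \<le> s * p\<^sup>2" using d s by simp_all
  have rest_le: "\<bar>rest\<bar> \<le> 12 * p ^ 3"
    using 1 2 3 4 5 6 7 h_nn(4) h_le(4) unfolding rest_def by (simp add: abs_le_iff)
  have "\<bar>s * \<delta> - (P 3 - P 4)\<bar> \<le> p\<^sup>2"
    using nn(4) le(4) p34 by linarith
  then have "\<bar>R * (s * \<delta> - (P 3 - P 4))\<bar> \<le> p\<^sup>2"
    using R mult_mono[of R 1 "\<bar>s * \<delta> - (P 3 - P 4)\<bar>" "p\<^sup>2"] by (simp add: abs_mult)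
  then show ?thesis using rest_le unfolding defect by linarith
qed

text \<open>
  For \<open>n \<ge> 3\<close> the expansion above applies. The first two defects, which would need sites before the
  extra one, are explicit polynomials in \<open>p\<close>, \<open>\<delta>\<close> and \<open>p\<^sub>3\<close>. The bound \<open>1 / 4\<close> makes
  \<open>1 - 2 p - 2 \<delta>\<close> nonnegative, which keeps the first of them within \<open>p\<^sup>2\<close>.
\<close>
lemma defect_bound:
  assumes "p \<le> 1 / 4" and "1 \<le> n"
  shows "\<bar>Q (Suc n) * \<mu> - Q n\<bar> \<le> p\<^sup>2 + 12 * p ^ 3"
proof -
  have p: "0 \<le> p" and p3: "0 \<le> p ^ 3" and d: "0 \<le> \<delta>" "\<delta> \<le> p"
    using run_bounds \<delta>_bounds by auto
  consider "n = 1" | "n = 2" | m where "n = m + 3"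
  proof -
    have "n = 1 \<or> n = 2 \<or> n = (n - 3) + 3" using assms(2) by linarith
    then show ?thesis using that by blast
  qed
  then show ?thesis
  proof cases
    case 1
    have eq: "Q (Suc n) * \<mu> - Q n = - (\<delta> * (p - \<delta> * (1 - 2 * p - 2 * \<delta>)))"
    proof -
      have "Q (Suc n) = 1 - p - \<delta>" "Q n = 1 - p"
        using 1 Q_one Q_two by (simp_all add: numeral_2_eq_2)
      then show ?thesis by (simp only: \<mu>_def power2_eq_square) (simp add: algebra_simps)
    qed
    have "0 \<le> \<delta> * (1 - 2 * p - 2 * \<delta>)"
      using assms(1) d by simp
    moreover have "\<delta> * (1 - 2 * p - 2 * \<delta>) \<le> p * 1"
      by (rule mult_mono) (use assms(1) d p in auto)
    ultimately have w: "0 \<le> p - \<delta> * (1 - 2 * p - 2 * \<delta>)" "p - \<delta> * (1 - 2 * p - 2 * \<delta>) \<le> p"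
      by linarith+
    have "0 \<le> \<delta> * (p - \<delta> * (1 - 2 * p - 2 * \<delta>))"
      by (rule mult_nonneg_nonneg[OF d(1) w(1)])
    moreover have "\<delta> * (p - \<delta> * (1 - 2 * p - 2 * \<delta>)) \<le> p * p"
      by (rule mult_mono[OF d(2) w(2) p w(1)])
    ultimately show ?thesis using p3 unfolding eq power2_eq_square by linarith
  next
    case 2
    define w where "w = p + 2 * \<delta> - p\<^sup>2 + P 3"
    have P3: "0 \<le> P 3" "P 3 \<le> p\<^sup>2" using run_bounds nonneg by auto
    have eq: "Q (Suc n) * \<mu> - Q n = p * (p - \<delta>) - P 3 + \<delta> * (p\<^sup>2 - P 3) - 2 * (\<delta>\<^sup>2 * w)"
    proof -
      have "Q (Suc n) = 1 - p - 2 * \<delta> + p\<^sup>2 - P 3" "Q n = 1 - p - \<delta>"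
        using 2 Q_two Q_three by (simp_all add: eval_nat_numeral)
      then show ?thesis by (simp only: w_def \<mu>_def power2_eq_square) (simp add: algebra_simps)
    qed
    have "p * p \<le> p * 1" using run_bounds by (intro mult_left_mono) auto
    then have w: "0 \<le> w" "w \<le> 3 * p"
      using P3 d p by (auto simp: w_def power2_eq_square)
    have "\<delta>\<^sup>2 * w \<le> p\<^sup>2 * (3 * p)" by (intro mult_mono power_mono) (use w d p in auto)
    moreover have "0 \<le> \<delta>\<^sup>2 * w" using w by simp
    moreover have "0 \<le> \<delta> * (p\<^sup>2 - P 3)" "\<delta> * (p\<^sup>2 - P 3) \<le> p * p\<^sup>2"
      using P3 d p by (auto intro!: mult_mono)
    moreover have "0 \<le> p * (p - \<delta>)" "p * (p - \<delta>) \<le> p * p"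
      using d p by (auto intro!: mult_left_mono)
    ultimately show ?thesis
      using P3 p3 unfolding eq by (simp add: abs_le_iff power2_eq_square power3_eq_cube)
  next
    case 3
    then show ?thesis using defect_bound_far[of m] by (simp add: H_def eval_nat_numeral)
  qed
qed

text \<open>
  Telescoping: passing from \<open>n\<close> to \<open>n + 1\<close> adds one defect to the error and divides the sum by
  \<open>\<mu> \<ge> 1\<close>. The induction starts at \<open>1\<close> because the error at \<open>0\<close>, namely \<open>1 - (Q 1 + \<delta>) = P 2\<close>, is
  in general of first order in \<open>p\<close>, whereas at \<open>1\<close> the first-order terms cancel.
\<close>
lemma geometric_approximation:
  assumes "p \<le> 1 / 4" and "1 \<le> n"
  shows "\<bar>Q n - (Q 1 + \<delta>) / \<mu> ^ n\<bar> \<le> 2 * p\<^sup>2 + (real n - 1) * (p\<^sup>2 + 12 * p ^ 3)"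
  using assms(2)
proof (induction n rule: dec_induct)
  case base
  have d: "0 \<le> \<delta>" "\<delta> \<le> p" and p: "0 \<le> p" "p \<le> 1" using \<delta>_bounds run_bounds by auto
  have "Q 1 * \<mu> - (Q 1 + \<delta>) = 2 * (\<delta>\<^sup>2 * (1 - p)) - p * \<delta>"
    unfolding Q_one by (simp add: \<mu>_def power2_eq_square algebra_simps)
  moreover have "0 \<le> \<delta>\<^sup>2 * (1 - p)" using p by simp
  moreover have "\<delta>\<^sup>2 * (1 - p) \<le> p\<^sup>2 * 1"
    by (intro mult_mono power_mono) (use d p in auto)
  moreover have "0 \<le> p * \<delta>" "p * \<delta> \<le> p * p" using d p by (auto intro!: mult_left_mono)
  ultimately have "\<bar>Q 1 * \<mu> - (Q 1 + \<delta>)\<bar> \<le> 2 * p\<^sup>2"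
    by (simp add: abs_le_iff power2_eq_square)
  then have "\<bar>(Q 1 * \<mu> - (Q 1 + \<delta>)) / \<mu>\<bar> \<le> 2 * p\<^sup>2"
    by (rule order_trans[OF abs_div_\<mu>_le])
  moreover have "Q 1 - (Q 1 + \<delta>) / \<mu> ^ 1 = (Q 1 * \<mu> - (Q 1 + \<delta>)) / \<mu>"
    using \<mu>_ge_one by (simp add: field_simps)
  ultimately show ?case by simp
next
  case (step n)
  let ?C = "Q 1 + \<delta>"
  have "Q (Suc n) - ?C / \<mu> ^ Suc n = ((Q n - ?C / \<mu> ^ n) + (Q (Suc n) * \<mu> - Q n)) / \<mu>"
    using \<mu>_ge_one by (simp add: field_simps)
  then have "\<bar>Q (Suc n) - ?C / \<mu> ^ Suc n\<bar> \<le> \<bar>(Q n - ?C / \<mu> ^ n) + (Q (Suc n) * \<mu> - Q n)\<bar>"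
    by (simp only: abs_div_\<mu>_le)
  also have "\<dots> \<le> (2 * p\<^sup>2 + (real n - 1) * (p\<^sup>2 + 12 * p ^ 3)) + (p\<^sup>2 + 12 * p ^ 3)"
    using step.IH defect_bound[OF assms(1) step.hyps(1)] by linarith
  also have "\<dots> = 2 * p\<^sup>2 + (real (Suc n) - 1) * (p\<^sup>2 + 12 * p ^ 3)"
    by (simp add: algebra_simps)
  finally show ?case .
qed

end

section \<open>Runs of a one-dependent stationary sequence\<close>

definition calm_then_run :: "'a measure \<Rightarrow> (nat \<Rightarrow> 'a \<Rightarrow> real) \<Rightarrow> real \<Rightarrow> nat \<Rightarrow> nat \<Rightarrow> real" where
  "calm_then_run M X x m k =
     measure M {\<omega> \<in> space M. (\<forall>i\<in>{1..m}. X i \<omega> \<le> x) \<and> (\<forall>i\<in>{m+1..m+k}. x < X i \<omega>)}"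

lemma generated_field_cylinder:
  assumes "finite J" "J \<subseteq> I" "\<And>i. i \<in> J \<Longrightarrow> B i \<in> sets borel"
  shows "{\<omega> \<in> space M. \<forall>i\<in>J. X i \<omega> \<in> B i} \<in> generated_field M X I"
proof -
  let ?A = "\<Union>i\<in>I. {X i -` A \<inter> space M | A. A \<in> sets borel}"
  interpret sigma_algebra "space M" "generated_field M X I"
    unfolding generated_field_def by (rule sigma_algebra_sigma_sets) auto
  have "{\<omega> \<in> space M. X i \<omega> \<in> B i} \<in> generated_field M X I" if "i \<in> J" for i
  proof -
    have "{\<omega> \<in> space M. X i \<omega> \<in> B i} = X i -` B i \<inter> space M" by auto
    then have "{\<omega> \<in> space M. X i \<omega> \<in> B i} \<in> ?A" using that assms by blast
    then show ?thesis unfolding generated_field_def by (rule sigma_sets.Basic)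
  qed
  then show ?thesis by (rule sets_Collect_finite_All) (use assms in auto)
qed

lemma stationary_cylinder:
  assumes "prob_space M" "\<And>i. i \<ge> 1 \<Longrightarrow> X i \<in> borel_measurable M"
    and "strictly_stationary M X"
    and "finite I" "I \<subseteq> {1..}" "\<And>i. i \<in> I \<Longrightarrow> B i \<in> sets borel"
  shows "measure M {\<omega> \<in> space M. \<forall>i\<in>I. X (i + h) \<omega> \<in> B i} =
         measure M {\<omega> \<in> space M. \<forall>i\<in>I. X i \<omega> \<in> B i}"
proof -
  have box: "Pi\<^sub>E I B \<in> sets (\<Pi>\<^sub>M i\<in>I. borel)"
    using assms by (intro sets_PiM_I_finite) auto
  have law: "measure (distr M (\<Pi>\<^sub>M i\<in>I. borel) (\<lambda>\<omega>. \<lambda>i\<in>I. X (i + h) \<omega>)) (Pi\<^sub>E I B) =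
      measure M {\<omega> \<in> space M. \<forall>i\<in>I. X (i + h) \<omega> \<in> B i}" for h
  proof -
    have "(\<lambda>\<omega>. \<lambda>i\<in>I. X (i + h) \<omega>) \<in> measurable M (\<Pi>\<^sub>M i\<in>I. borel)"
      by (rule measurable_restrict) (use assms in auto)
    then have "measure (distr M (\<Pi>\<^sub>M i\<in>I. borel) (\<lambda>\<omega>. \<lambda>i\<in>I. X (i + h) \<omega>)) (Pi\<^sub>E I B) =
        measure M ((\<lambda>\<omega>. \<lambda>i\<in>I. X (i + h) \<omega>) -` Pi\<^sub>E I B \<inter> space M)"
      using box by (rule measure_distr)
    also have "(\<lambda>\<omega>. \<lambda>i\<in>I. X (i + h) \<omega>) -` Pi\<^sub>E I B \<inter> space M =
        {\<omega> \<in> space M. \<forall>i\<in>I. X (i + h) \<omega> \<in> B i}"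
      by (auto simp: PiE_iff)
    finally show ?thesis .
  qed
  have "distr M (\<Pi>\<^sub>M i\<in>I. borel) (\<lambda>\<omega>. \<lambda>i\<in>I. X (i + h) \<omega>) =
        distr M (\<Pi>\<^sub>M i\<in>I. borel) (\<lambda>\<omega>. \<lambda>i\<in>I. X i \<omega>)"
    using assms unfolding strictly_stationary_def by blast
  with law[of h] law[of 0] show ?thesis by simp
qed

text \<open>
  The only use of one-dependence: site \<open>m + 1\<close> is unconstrained, so the factors before and after it
  are independent, and stationarity moves the second one to the origin. The set \<open>B\<close> is \<open>{..x}\<close> for
  the recurrence and \<open>{x<..}\<close> for the submultiplicativity of runs.
\<close>
lemma cylinder_skip_run:
  assumes "prob_space M" "\<And>i. i \<ge> 1 \<Longrightarrow> X i \<in> borel_measurable M"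
    and "strictly_stationary M X" "one_dependent M X"
    and "B \<in> sets borel"
  shows "measure M {\<omega> \<in> space M. (\<forall>i\<in>{1..m}. X i \<omega> \<in> B) \<and> (\<forall>i\<in>{m+2..m+1+k}. x < X i \<omega>)} =
    measure M {\<omega> \<in> space M. \<forall>i\<in>{1..m}. X i \<omega> \<in> B} * calm_then_run M X x 0 k"
proof -
  interpret prob_space M by fact
  let ?A = "{\<omega> \<in> space M. \<forall>i\<in>{1..m}. X i \<omega> \<in> B}"
  let ?R = "{\<omega> \<in> space M. \<forall>i\<in>{m+2..m+1+k}. X i \<omega> \<in> {x<..}}"
  have img: "{m+2..m+1+k} = (\<lambda>i. i + (m + 1)) ` {1..k}"
    by (subst image_add_atLeastAtMost') (simp add: ac_simps)
  have "?R = {\<omega> \<in> space M. \<forall>i\<in>{1..k}. X (i + (m + 1)) \<omega> \<in> {x<..}}"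
    unfolding img by auto
  then have run: "prob ?R = calm_then_run M X x 0 k"
    using stationary_cylinder[OF assms(1-3), of "{1..k}" "\<lambda>_. {x<..}" "m + 1"]
    by (simp add: calm_then_run_def)
  have eq: "{\<omega> \<in> space M. (\<forall>i\<in>{1..m}. X i \<omega> \<in> B) \<and> (\<forall>i\<in>{m+2..m+1+k}. x < X i \<omega>)} = ?A \<inter> ?R"
    by auto
  have "prob (?A \<inter> ?R) = prob ?A * prob ?R"
  \<comment> \<open>One-dependence speaks of \<open>t \<ge> 1\<close> only; for \<open>m = 0\<close> the first factor is trivial.\<close>
  proof (cases "m = 0")
    case True
    then have "?A = space M" "?A \<inter> ?R = ?R" by auto
    then show ?thesis by (simp add: prob_space)
  next
    case False
    then have "indep_set (generated_field M X {1..m}) (generated_field M X {m + 2..})"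
      using assms(4) unfolding one_dependent_def by simp
    moreover have "?A \<in> generated_field M X {1..m}"
      using assms(5) by (intro generated_field_cylinder) auto
    moreover have "?R \<in> generated_field M X {m + 2..}"
      by (intro generated_field_cylinder) auto
    ultimately show ?thesis by (rule indep_setD)
  qed
  then show ?thesis unfolding eq run .
qed

lemma calm_then_run_array:
  assumes "prob_space M" "\<And>i. i \<ge> 1 \<Longrightarrow> X i \<in> borel_measurable M"
    and "strictly_stationary M X" "one_dependent M X"
  shows "run_array (calm_then_run M X x)"
proof
  interpret prob_space M by fact
  have meas: "X i \<in> borel_measurable M" if "i \<in> {Suc a..b}" for i a b
    using that assms(2) by simp
  fix m k j
  show "0 \<le> calm_then_run M X x m k" by (simp add: calm_then_run_def)
  show "calm_then_run M X x 0 0 = 1" by (simp add: calm_then_run_def prob_space)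
  let ?S = "{\<omega> \<in> space M. (\<forall>i\<in>{1..m}. X i \<omega> \<le> x) \<and> (\<forall>i\<in>{m+2..m+1+k}. x < X i \<omega>)}"
  let ?U = "{\<omega> \<in> space M. (\<forall>i\<in>{1..Suc m}. X i \<omega> \<le> x) \<and> (\<forall>i\<in>{Suc m+1..Suc m+k}. x < X i \<omega>)}"
  let ?V = "{\<omega> \<in> space M. (\<forall>i\<in>{1..m}. X i \<omega> \<le> x) \<and> (\<forall>i\<in>{m+1..m+Suc k}. x < X i \<omega>)}"
  have low: "{1..Suc m} = insert (Suc m) {1..m}"
    by auto
  have high: "{m+1..m+Suc k} = insert (Suc m) {m+2..m+1+k}"
    by auto
  have S: "?S = ?U \<union> ?V" "?U \<inter> ?V = {}"
    unfolding low high by auto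
  have events: "?U \<in> events" "?V \<in> events"
    using meas by (measurable; simp)+
  have "prob ?S = prob ?U + prob ?V"
    unfolding S(1) by (rule finite_measure_Union[OF events S(2)])
  moreover have "prob ?S = calm_then_run M X x m 0 * calm_then_run M X x 0 k"
    using cylinder_skip_run[OF assms, of "{..x}" m k x] by (simp add: calm_then_run_def)
  ultimately show "calm_then_run M X x (Suc m) k + calm_then_run M X x m (Suc k) =
      calm_then_run M X x m 0 * calm_then_run M X x 0 k"
    by (simp add: calm_then_run_def)
  have "calm_then_run M X x 0 (j + 1 + k) \<le>
      prob {\<omega> \<in> space M. (\<forall>i\<in>{1..j}. X i \<omega> \<in> {x<..}) \<and> (\<forall>i\<in>{j+2..j+1+k}. x < X i \<omega>)}"
    unfolding calm_then_run_def
  proof (rule finite_measure_mono)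
    show "{\<omega> \<in> space M. (\<forall>i\<in>{1..j}. X i \<omega> \<in> {x<..}) \<and> (\<forall>i\<in>{j+2..j+1+k}. x < X i \<omega>)} \<in> events"
      using meas by (measurable; simp)
  qed auto
  also have "\<dots> = calm_then_run M X x 0 j * calm_then_run M X x 0 k"
    using cylinder_skip_run[OF assms, of "{x<..}" j k x] by (simp add: calm_then_run_def)
  finally show "calm_then_run M X x 0 (j + 1 + k) \<le>
      calm_then_run M X x 0 j * calm_then_run M X x 0 k" .
qed

lemma q_eq_calm:
  assumes "1 \<le> n"
  shows "q M X x n = calm_then_run M X x n 0"
  using assms by (simp add: q_def calm_then_run_def)

section \<open>The constants\<close>

text \<open>
  Eliminating the cubic terms from two roots \<open>t \<noteq> u\<close> leaves \<open>\<alpha> t u (t + u) = 1\<close>, and the left side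
  is negative if both roots are.
\<close>
lemma cubic_negative_root_unique:
  fixes \<alpha> t u :: real
  assumes "0 < \<alpha>" "t < u" "u < 0" "\<alpha> * t ^ 3 - t + 1 = 0" "\<alpha> * u ^ 3 - u + 1 = 0"
  shows False
proof -
  have "(t - u) * (\<alpha> * (u * t) * (t + u) - 1) = u * (\<alpha> * t ^ 3 - t + 1) - t * (\<alpha> * u ^ 3 - u + 1)"
    by (simp add: algebra_simps power3_eq_cube)
  then have "\<alpha> * (u * t) * (t + u) = 1" using assms by simp
  moreover have "\<alpha> * (u * t) * (t + u) < 0"
    using assms by (intro mult_pos_neg mult_pos_pos mult_neg_neg) auto
  ultimately show False by simp
qed

text \<open>
  The intermediate value theorem gives a root in \<open>[1, 2]\<close> and one that is not positive, so the sorted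
  list has a second entry. At most one root is negative and \<open>0\<close> is not a root, hence that entry is
  positive, and a positive root equals \<open>1 + \<alpha> t\<^sup>3 > 1\<close>.
\<close>
lemma t2_gt_one:
  assumes "0 < \<alpha>" "\<alpha> \<le> 1 / 10"
  shows "1 < t2 \<alpha>"
proof -
  let ?f = "\<lambda>t::real. \<alpha> * t ^ 3 - t + 1"
  define S where "S = {t. ?f t = 0}"
  define xs where "xs = sorted_list_of_set S"
  have "finite {t. poly [:1, -1, 0, \<alpha>:] t = 0}"
    using assms by (intro poly_roots_finite) auto
  moreover have "{t. poly [:1, -1, 0, \<alpha>:] t = 0} = S"
    by (auto simp: S_def power3_eq_cube algebra_simps)
  ultimately have fin: "finite S" by simp
  then have xs: "set xs = S" "sorted_wrt (<) xs" "length xs = card S"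
    by (simp_all add: xs_def)
  obtain a where a: "1 \<le> a" "?f a = 0"
  proof -
    have "continuous_on {1..2} ?f" by (intro continuous_intros)
    moreover have "?f 2 \<le> 0" "0 \<le> ?f 1" using assms by simp_all
    ultimately obtain a where "1 \<le> a" "?f a = 0"
      using IVT2'[of ?f 2 0 1] by force
    then show ?thesis by (rule that)
  qed
  \<comment> \<open>A point so far to the left that the cubic term has taken over.\<close>
  define T where "T = 1 + 1 / \<alpha>"
  have T: "1 \<le> T" "\<alpha> * T = \<alpha> + 1" using assms by (auto simp: T_def field_simps)
  have "\<alpha> * T ^ 3 = (\<alpha> * T) * T * T" by (simp add: power3_eq_cube)
  also have "\<dots> = T * T + \<alpha> * T * T" using T by (simp add: algebra_simps)
  also have "\<dots> \<ge> T + 1"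
  proof -
    have "1 * T \<le> T * T" "0 \<le> \<alpha> * T * T" using T(1) assms by (auto intro: mult_right_mono)
    moreover have "\<alpha> * T * T = T + \<alpha> * T" using T(2) by (simp add: algebra_simps)
    ultimately show ?thesis using T assms by linarith
  qed
  finally have "?f (- T) \<le> 0" by (simp add: power3_eq_cube)
  then obtain c where c: "c \<le> 0" "?f c = 0"
  proof -
    have "continuous_on {- T..0} ?f" by (intro continuous_intros)
    then obtain c where "c \<le> 0" "?f c = 0"
      using IVT'[of ?f "- T" 0 0, OF \<open>?f (- T) \<le> 0\<close>] T(1) by force
    then show ?thesis by (rule that)
  qed
  have "card {a, c} \<le> card S"
    using a c fin by (intro card_mono) (auto simp: S_def)
  then have len: "2 \<le> length xs" using a c xs by auto
  then have lt: "xs ! 0 < xs ! 1"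
    using sorted_wrt_nth_less[OF xs(2), of 0 1] by linarith
  have roots: "?f (xs ! 0) = 0" "?f (xs ! 1) = 0"
  proof -
    have "xs ! 0 \<in> S" "xs ! 1 \<in> S"
      using len nth_mem[of 0 xs] nth_mem[of 1 xs] unfolding xs(1) by linarith+
    then show "?f (xs ! 0) = 0" "?f (xs ! 1) = 0" unfolding S_def by blast+
  qed
  have "\<not> xs ! 1 < 0"
    using cubic_negative_root_unique[OF assms(1) lt _ roots] by blast
  moreover have "xs ! 1 \<noteq> 0"
  proof
    assume "xs ! 1 = 0"
    then show False using roots(2) unfolding \<open>xs ! 1 = 0\<close> by simp
  qed
  ultimately have "0 < xs ! 1" by linarith
  then have "0 < \<alpha> * (xs ! 1) ^ 3" using assms(1) by simp
  then have "1 < xs ! 1" using roots(2) by linarith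
  then show ?thesis unfolding t2_def xs_def S_def .
qed

text \<open>
  The numerator of \<open>K\<close> is at least \<open>10 + 2 l (1 + 3 \<alpha>) \<cdot> 2 \<ge> 14\<close>, and its denominator lies in
  \<open>(0, 1]\<close>: positivity follows from that of the last factor in the denominator of \<open>E\<close>, because
  \<open>\<alpha> \<eta>\<^sup>2 (1 + \<eta> - 2 \<alpha> \<eta>)\<^sup>2 \<ge> 2 \<alpha> \<eta>\<close>. Every summand of \<open>L\<close> and of \<open>E\<close> is nonnegative.
\<close>
lemma constants_bounds:
  assumes \<alpha>: "0 < \<alpha>" "\<alpha> \<le> 1 / 10" and l: "1 \<le> l" and den: "denominators_positive \<alpha> l"
  shows "12 \<le> K \<alpha> l" and "0 \<le> Gam \<alpha> l"
proof -
  define \<eta> where "\<eta> = 1 + l * \<alpha>"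
  define D where "D = 1 - \<alpha> * \<eta>\<^sup>2"
  have \<eta>: "1 \<le> \<eta>" using \<alpha> l by (simp add: \<eta>_def)
  have D: "0 < D" "D \<le> 1"
    using den \<alpha> by (auto simp: denominators_positive_def D_def \<eta>_def eta_def)
  have Ed: "\<alpha> * \<eta>\<^sup>2 * (1 + \<eta> - 2 * \<alpha> * \<eta>)\<^sup>2 < D\<^sup>2"
    using den by (simp add: denominators_positive_def E_denominator_factor_def D_def \<eta>_def eta_def Let_def)
  have "2 * \<alpha> * \<eta> \<le> (\<alpha> * \<eta>\<^sup>2) * 2"
    using \<alpha> \<eta> by (simp add: power2_eq_square)
  also have "\<dots> \<le> (\<alpha> * \<eta>\<^sup>2) * (1 + \<eta> - 2 * \<alpha> * \<eta>)\<^sup>2"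
  proof (rule mult_left_mono)
    have "\<alpha> * \<eta> \<le> 1 / 10 * \<eta>" using \<alpha> \<eta> by (intro mult_right_mono) auto
    then have "3 / 2 \<le> 1 + \<eta> - 2 * \<alpha> * \<eta>" using \<eta> by linarith
    then have "(3 / 2)\<^sup>2 \<le> (1 + \<eta> - 2 * \<alpha> * \<eta>)\<^sup>2" by (intro power_mono) auto
    then show "2 \<le> (1 + \<eta> - 2 * \<alpha> * \<eta>)\<^sup>2" by (simp add: power2_eq_square)
  qed (use \<alpha> in auto)
  finally have "2 * \<alpha> * \<eta> < D\<^sup>2" using Ed by linarith
  then have "2 * \<alpha> * \<eta> / D\<^sup>2 < 1" using D by simp
  moreover have "0 \<le> 2 * \<alpha> * \<eta> / D\<^sup>2" using \<alpha> \<eta> by simp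
  ultimately have Kd: "0 < 1 - 2 * \<alpha> * \<eta> / D\<^sup>2" "1 - 2 * \<alpha> * \<eta> / D\<^sup>2 \<le> 1" by simp_all
  have num1: "10 \<le> (11 - 3 * \<alpha>) / (1 - \<alpha>)\<^sup>2"
  proof -
    have "(1 - \<alpha>)\<^sup>2 \<le> 1" using \<alpha> by (simp add: power_le_one)
    then show ?thesis using \<alpha> by (simp add: le_divide_eq)
  qed
  have num2: "2 \<le> (2 + 3 * l * \<alpha> - \<alpha> * (2 - l * \<alpha>) * \<eta>\<^sup>2) / D ^ 3"
  proof -
    have "2 * D ^ 3 \<le> 2 * D" using D power_decreasing[of 1 3 D] by simp
    also have "\<dots> \<le> 2 * D + (3 * l * \<alpha> + l * \<alpha> * (\<alpha> * \<eta>\<^sup>2))" using l \<alpha> by simp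
    also have "\<dots> = 2 + 3 * l * \<alpha> - \<alpha> * (2 - l * \<alpha>) * \<eta>\<^sup>2" by (simp add: D_def algebra_simps)
    finally show ?thesis using D by (simp add: le_divide_eq)
  qed
  have "2 * 1 \<le> 2 * l * (1 + 3 * \<alpha>)"
    using l \<alpha> mult_mono[of 1 l 1 "1 + 3 * \<alpha>"] by simp
  then have "2 * 2 \<le> 2 * l * (1 + 3 * \<alpha>) *
      ((2 + 3 * l * \<alpha> - \<alpha> * (2 - l * \<alpha>) * \<eta>\<^sup>2) / D ^ 3)"
    using num2 by (intro mult_mono) auto
  then have "12 \<le> (11 - 3 * \<alpha>) / (1 - \<alpha>)\<^sup>2 + 2 * l * (1 + 3 * \<alpha>) *
      ((2 + 3 * l * \<alpha> - \<alpha> * (2 - l * \<alpha>) * \<eta>\<^sup>2) / D ^ 3)" (is "12 \<le> ?N")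
    using num1 by linarith
  moreover have "?N \<le> ?N / (1 - 2 * \<alpha> * \<eta> / D\<^sup>2)"
  proof -
    have "z \<le> z / w" if "0 < w" "w \<le> 1" "0 \<le> z" for z w :: real
      using that by (simp add: le_divide_eq mult_left_le)
    then show ?thesis using Kd \<open>12 \<le> ?N\<close> by (meson order_trans zero_le_numeral)
  qed
  moreover have "K \<alpha> l = ?N / (1 - 2 * \<alpha> * \<eta> / D\<^sup>2)"
    by (simp add: K_def D_def \<eta>_def)
  ultimately show K: "12 \<le> K \<alpha> l"
    by linarith
  have "0 \<le> L \<alpha> l"
    using K \<alpha> by (simp add: L_def)
  moreover have "0 \<le> E \<alpha> l"
  proof -
    have "0 \<le> \<alpha> * \<eta>" using \<alpha> \<eta> by simp
    then have "0 \<le> 1 + \<alpha> * (\<eta> - 2)"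
      using \<alpha> unfolding right_diff_distrib by linarith
    moreover have "0 \<le> 1 + \<eta> + (1 - 3 * \<alpha>) * \<eta>\<^sup>2" using \<alpha> \<eta> by simp
    moreover have "0 < E_denominator_factor \<alpha> l" using den by (simp add: denominators_positive_def)
    moreover have "0 \<le> \<eta> ^ 5" "0 \<le> (1 + (1 - 2 * \<alpha>) * \<eta>) ^ 4" "0 \<le> (1 - \<alpha> * \<eta>\<^sup>2) ^ 4"
      using \<eta> by simp_all
    ultimately have "0 \<le> \<eta> ^ 5 * (1 + (1 - 2 * \<alpha>) * \<eta>) ^ 4 * (1 + \<alpha> * (\<eta> - 2)) *
              (1 + \<eta> + (1 - 3 * \<alpha>) * \<eta>\<^sup>2)
            / (2 * (1 - \<alpha> * \<eta>\<^sup>2) ^ 4 * E_denominator_factor \<alpha> l)"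
      by (intro divide_nonneg_nonneg mult_nonneg_nonneg) linarith+
    then show ?thesis unfolding E_def Let_def eta_def \<eta>_def[symmetric] by linarith
  qed
  ultimately show "0 \<le> Gam \<alpha> l" by (simp add: Gam_def)
qed

text \<open>
  The theorem assumes \<open>1 - \<alpha> \<le> q\<^sub>1\<close>; with \<open>q\<^sub>1 < 1\<close> this makes \<open>\<alpha>\<close> positive, without which the
  equation defining \<open>t2\<close> would not have the required roots.
\<close>
lemma exceedance_pos:
  assumes "prob_space M" "X 1 \<in> borel_measurable M"
    and "ereal x < Sup (ereal ` {u. F M X u < 1})"
  shows "q M X x 1 < 1"
proof -
  interpret prob_space M by fact
  obtain u where u: "x < u" "F M X u < 1"
    using assms(3) by (auto simp: less_Sup_iff)
  have "F M X x \<le> F M X u"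
    unfolding F_def using u(1) assms(2) by (intro finite_measure_mono) auto
  moreover have "q M X x 1 = F M X x" by (simp add: q_def F_def)
  ultimately show ?thesis using u(2) by linarith
qed

section \<open>Geometric approximation of the distribution of the maximum\<close>

theorem theorem2p6:
  fixes M :: "'a measure" and X :: "nat \<Rightarrow> 'a \<Rightarrow> real" and x \<alpha> l :: real and n :: nat
  assumes "prob_space M"
    and "\<And>i. i \<ge> 1 \<Longrightarrow> X i \<in> borel_measurable M"
    and "strictly_stationary M X"
    and "one_dependent M X"
    and "Inf (ereal ` {u. F M X u > 0}) < ereal x"
    and "ereal x < Sup (ereal ` {u. F M X u < 1})"
    and "l > (t2 \<alpha>) ^ 3"
    and "denominators_positive \<alpha> l"
    and "q M X x 1 \<ge> 1 - \<alpha>"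
    and "1 - \<alpha> \<ge> 0.9"
    and "n \<ge> 1"
  shows "\<bar>q M X x n -
            (2 * q M X x 1 - q M X x 2) /
            (1 + q M X x 1 - q M X x 2 + 2 * (q M X x 1 - q M X x 2)\<^sup>2) ^ n\<bar>
         \<le> Delta2 \<alpha> l n (q M X x 1) * (1 - q M X x 1)\<^sup>2"
proof -
  interpret run_array "calm_then_run M X x"
    by (rule calm_then_run_array[OF assms(1-4)])
  define r where "r = p"
  have q1: "q M X x 1 = 1 - r" and q2: "q M X x 2 = 1 - r - \<delta>"
    using q_eq_calm[of 1 M X x] q_eq_calm[of 2 M X x] Q_one Q_two by (simp_all add: r_def)
  have r: "0 < r" "r \<le> \<alpha>" "\<alpha> \<le> 1 / 10"
    using exceedance_pos[OF assms(1) assms(2)[of 1] assms(6)] q1 assms(9,10) by auto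
  then have "1 < t2 \<alpha>" by (intro t2_gt_one) auto
  then have "1 \<le> l" using assms(7) one_le_power[of "t2 \<alpha>" 3] by linarith
  then have K: "12 \<le> K \<alpha> l" and Gam: "0 \<le> Gam \<alpha> l"
    using constants_bounds[of \<alpha> l] r assms(8) by auto
  have "\<bar>q M X x n - (2 * q M X x 1 - q M X x 2) /
      (1 + q M X x 1 - q M X x 2 + 2 * (q M X x 1 - q M X x 2)\<^sup>2) ^ n\<bar> =
      \<bar>Q n - (Q 1 + \<delta>) / \<mu> ^ n\<bar>"
    unfolding q1 q2 q_eq_calm[OF assms(11)] Q_one \<mu>_def r_def by (simp add: algebra_simps)
  also have "\<dots> \<le> 2 * r\<^sup>2 + (real n - 1) * (r\<^sup>2 + 12 * r ^ 3)"
    using geometric_approximation[OF _ assms(11)] r by (simp add: r_def)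
  also have "\<dots> \<le> 3 * r\<^sup>2 + Gam \<alpha> l * r * r\<^sup>2 + real n * (r\<^sup>2 + K \<alpha> l * r ^ 3)"
  proof (intro add_mono mult_mono)
    have "0 \<le> Gam \<alpha> l * r * r\<^sup>2" using Gam r by simp
    then show "2 * r\<^sup>2 \<le> 3 * r\<^sup>2 + Gam \<alpha> l * r * r\<^sup>2" by simp
  qed (use K r in auto)
  also have "\<dots> = Delta2 \<alpha> l n (q M X x 1) * (1 - q M X x 1)\<^sup>2"
    unfolding q1 Delta2_def by (simp add: algebra_simps power2_eq_square power3_eq_cube)
  finally show ?thesis .
qed

end
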